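(* Let $\varepsilon,\tau_1,\tau_2>0$, let $X$ and $Y$ be complete separable metric spaces, let $\mu\in\mathcal{M}_+(X)$, $\nu\in\mathcal{M}_+(Y)$ be positive measures, and let $c\in L^\infty(X\times Y)$ be a cost function. Then the dual problem $$\sup\left\{ D^{\tau_1,\tau_2}_{\varepsilon}(u,v) \ :\ u\in L^\infty(X),\ v\in L^\infty(Y)\right\}$$ admits a maximizer, i.e. there exist $\bar u\in L^\infty(X)$ and $\bar v\in L^\infty(Y)$ at which the supremum is attained.
   Context: $\mathcal{M}_+(X)$ denotes the positive (finite, nonnegative Borel) measures on $X$; the measures $\mu,\nu$ are finite and nonzero, i.e. $0<\mu(X)<\infty$ and $0<\nu(Y)<\infty$. $L^\infty(X)$, $L^\infty(Y)$, $L^\infty(X\times Y)$ are the spaces of real-valued essentially bounded measurable functions with respect to $\mu$, $\nu$, $\mu\otimes\nu$ respectively (functions equal a.e. are identified). The unbalanced dual functional $D^{\tau_1,\tau_2}_{\varepsilon}:L^\infty(X)\times L^\infty(Y)\to\mathbb{R}$ is $$D^{\tau_1,\tau_2}_{\varepsilon}(u,v)=-\tau_1\int_X\left(e^{-u/\tau_1}-1\right)d\mu-\tau_2\int_Y\left(e^{-v/\tau_2}-1\right)d\nu-\varepsilon\int_{X\times Y}e^{\frac{u(x)+v(y)-c(x,y)}{\varepsilon}}\,d(\mu\otimes\nu)(x,y).$$ *)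

theory Defs
  imports "HOL-Analysis.Analysis"
begin

text \<open>Elements of \<open>L\<^sup>\<infinity>(M)\<close> are given by measurable representatives; they are not quotiented by
  almost-everywhere equality.\<close>

definition Linfty :: "'a measure \<Rightarrow> ('a \<Rightarrow> real) set" where
  "Linfty M = {f \<in> borel_measurable M. \<exists>C. AE x in M. \<bar>f x\<bar> \<le> C}"

text \<open>For arguments in \<open>L\<^sup>\<infinity>\<close> and finite measures all three integrands are essentially bounded, so
  the Bochner integrals below are genuine and depend only on almost-everywhere classes.\<close>

definition dual_functional ::
  "real \<Rightarrow> real \<Rightarrow> real \<Rightarrow> 'a measure \<Rightarrow> 'b measure \<Rightarrow> ('a \<times> 'b \<Rightarrow> real) \<Rightarrow>
    ('a \<Rightarrow> real) \<Rightarrow> ('b \<Rightarrow> real) \<Rightarrow> real" where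
  "dual_functional \<tau>1 \<tau>2 \<epsilon> \<mu> \<nu> c u v =
    - \<tau>1 * (\<integral>x. (exp (- u x / \<tau>1) - 1) \<partial>\<mu>)
    - \<tau>2 * (\<integral>y. (exp (- v y / \<tau>2) - 1) \<partial>\<nu>)
    - \<epsilon> * (\<integral>(x, y). exp ((u x + v y - c (x, y)) / \<epsilon>) \<partial>(\<mu> \<Otimes>\<^sub>M \<nu>))"

end

theory Submission
  imports Defs
begin

text \<open>
  The optimality condition in \<open>u\<close> for fixed \<open>v\<close> reads
  \<open>u x = - (\<epsilon> \<tau>1 / (\<epsilon> + \<tau>1)) * ln (\<integral>y. exp ((v y - c (x, y)) / \<epsilon>) \<partial>\<nu>)\<close>, and symmetrically in \<open>v\<close>.
  Since the logarithm of an integrated exponential is 1-Lipschitz in the sup norm, these two maps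
  are contractions with factors \<open>\<tau>1 / (\<epsilon> + \<tau>1)\<close> and \<open>\<tau>2 / (\<epsilon> + \<tau>2)\<close>, so their composition has a
  fixed point among bounded measurable functions. The fixed point is a critical point of the dual
  functional, and concavity (the tangent inequality for \<open>exp\<close>, integrated with Fubini) makes it a
  global maximizer.
\<close>

section \<open>Pointwise bounded functions and closure properties of L-infinity\<close>

text \<open>The bound holds at every point, not just almost everywhere: the contraction argument
  compares functions and takes limits pointwise, so no null sets have to be carried along the
  iteration.\<close>

definition bounded_measurable :: "'a measure \<Rightarrow> ('a \<Rightarrow> real) set" where
  "bounded_measurable M = {f \<in> borel_measurable M. \<exists>C. \<forall>x\<in>space M. \<bar>f x\<bar> \<le> C}"

lemma bounded_measurableI:
  "f \<in> borel_measurable M \<Longrightarrow> (\<And>x. x \<in> space M \<Longrightarrow> \<bar>f x\<bar> \<le> C) \<Longrightarrow> f \<in> bounded_measurable M"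
  unfolding bounded_measurable_def by blast

lemma bounded_measurableE:
  assumes "f \<in> bounded_measurable M"
  obtains C where "f \<in> borel_measurable M" "C \<ge> 0" "\<And>x. x \<in> space M \<Longrightarrow> \<bar>f x\<bar> \<le> C"
proof -
  obtain C where C: "f \<in> borel_measurable M" "\<forall>x\<in>space M. \<bar>f x\<bar> \<le> C"
    using assms unfolding bounded_measurable_def by blast
  show ?thesis
    by (rule that[of "max C 0"]) (use C in \<open>auto simp: max.coboundedI1\<close>)
qed

lemma LinftyI: "f \<in> borel_measurable M \<Longrightarrow> (AE x in M. \<bar>f x\<bar> \<le> C) \<Longrightarrow> f \<in> Linfty M"
  unfolding Linfty_def by blast

lemma LinftyE:
  assumes "f \<in> Linfty M"
  obtains C where "f \<in> borel_measurable M" "AE x in M. \<bar>f x\<bar> \<le> C"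
  using assms unfolding Linfty_def by blast

lemma Linfty_measurable: "f \<in> Linfty M \<Longrightarrow> f \<in> borel_measurable M"
  unfolding Linfty_def by blast

lemma bounded_measurable_imp_Linfty: "f \<in> bounded_measurable M \<Longrightarrow> f \<in> Linfty M"
  by (erule bounded_measurableE, rule LinftyI) auto

lemma (in finite_measure) Linfty_integrable: "f \<in> Linfty M \<Longrightarrow> integrable M f"
  by (erule LinftyE, rule integrable_const_bound) auto

lemma Linfty_const: "(\<lambda>_. a) \<in> Linfty M"
  by (rule LinftyI[where C="\<bar>a\<bar>"]) auto

lemma Linfty_add:
  assumes "f \<in> Linfty M" "g \<in> Linfty M"
  shows "(\<lambda>x. f x + g x) \<in> Linfty M"
proof -
  obtain C where C: "f \<in> borel_measurable M" "AE x in M. \<bar>f x\<bar> \<le> C"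
    by (rule LinftyE[OF assms(1)])
  obtain D where D: "g \<in> borel_measurable M" "AE x in M. \<bar>g x\<bar> \<le> D"
    by (rule LinftyE[OF assms(2)])
  have "AE x in M. \<bar>f x + g x\<bar> \<le> C + D"
    using C(2) D(2) by eventually_elim linarith
  with C D show ?thesis
    by (intro LinftyI) auto
qed

lemma Linfty_mult:
  assumes "f \<in> Linfty M" "g \<in> Linfty M"
  shows "(\<lambda>x. f x * g x) \<in> Linfty M"
proof -
  obtain C where C: "f \<in> borel_measurable M" "AE x in M. \<bar>f x\<bar> \<le> C"
    by (rule LinftyE[OF assms(1)])
  obtain D where D: "g \<in> borel_measurable M" "AE x in M. \<bar>g x\<bar> \<le> D"
    by (rule LinftyE[OF assms(2)])
  have "AE x in M. \<bar>f x * g x\<bar> \<le> C * D"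
    using C(2) D(2) by eventually_elim (auto simp: abs_mult intro!: mult_mono)
  with C D show ?thesis
    by (intro LinftyI) auto
qed

lemma Linfty_diff:
  assumes "f \<in> Linfty M" "g \<in> Linfty M"
  shows "(\<lambda>x. f x - g x) \<in> Linfty M"
  using Linfty_add[OF assms(1) Linfty_mult[OF Linfty_const[of "-1"] assms(2)]] by simp

lemma Linfty_divide: "f \<in> Linfty M \<Longrightarrow> (\<lambda>x. f x / a) \<in> Linfty M"
  using Linfty_mult[OF Linfty_const[of "inverse a"], of f] by (simp add: divide_inverse mult.commute)

lemma Linfty_minus: "f \<in> Linfty M \<Longrightarrow> (\<lambda>x. - f x) \<in> Linfty M"
  using Linfty_mult[OF Linfty_const[of "-1"], of f] by simp

lemma Linfty_exp:
  assumes "f \<in> Linfty M"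
  shows "(\<lambda>x. exp (f x)) \<in> Linfty M"
proof -
  obtain C where C: "f \<in> borel_measurable M" "AE x in M. \<bar>f x\<bar> \<le> C"
    by (rule LinftyE[OF assms])
  have "AE x in M. \<bar>exp (f x)\<bar> \<le> exp C"
    using C(2) by eventually_elim auto
  with C show ?thesis
    by (intro LinftyI) auto
qed

context pair_sigma_finite
begin

lemma Linfty_fst:
  assumes "f \<in> Linfty M1"
  shows "(\<lambda>z. f (fst z)) \<in> Linfty (M1 \<Otimes>\<^sub>M M2)"
proof -
  obtain C where C: "f \<in> borel_measurable M1" "AE x in M1. \<bar>f x\<bar> \<le> C"
    by (rule LinftyE[OF assms])
  note [measurable] = C(1)
  have "AE z in M1 \<Otimes>\<^sub>M M2. \<bar>f (fst z)\<bar> \<le> C"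
  proof (rule AE_pair_measure)
    show "AE x in M1. AE y in M2. \<bar>f (fst (x, y))\<bar> \<le> C"
      using C(2) by eventually_elim simp
  qed measurable
  then show ?thesis
    by (intro LinftyI) auto
qed

lemma Linfty_snd:
  assumes "f \<in> Linfty M2"
  shows "(\<lambda>z. f (snd z)) \<in> Linfty (M1 \<Otimes>\<^sub>M M2)"
proof -
  obtain C where C: "f \<in> borel_measurable M2" "AE x in M2. \<bar>f x\<bar> \<le> C"
    by (rule LinftyE[OF assms])
  note [measurable] = C(1)
  have "AE z in M1 \<Otimes>\<^sub>M M2. \<bar>f (snd z)\<bar> \<le> C"
  proof (rule AE_pair_measure)
    show "AE x in M1. AE y in M2. \<bar>f (snd (x, y))\<bar> \<le> C"
      using C(2) by simp
  qed measurable
  then show ?thesis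
    by (intro LinftyI) auto
qed

end

section \<open>Critical points are global maximizers\<close>

lemma exp_tangent: "exp a + exp a * (b - a) \<le> exp (b::real)"
proof -
  have "exp a * (1 + (b - a)) \<le> exp a * exp (b - a)"
    by (intro mult_left_mono exp_ge_add_one_self) auto
  then show ?thesis
    by (simp add: exp_diff algebra_simps)
qed

text \<open>Each exponential lies above its tangent at \<open>(u, v)\<close>. After integration,
  Fubini and the two criticality equations turn the linear terms of the product integral into those
  of the marginal integrals, with opposite signs, so they cancel.\<close>

lemma dual_functional_le_critical_point:
  fixes M :: "'a measure" and N :: "'b measure"
  assumes "finite_measure M" "finite_measure N"
    and pos: "\<epsilon> > 0" "\<tau>1 > 0" "\<tau>2 > 0"
    and c: "c \<in> Linfty (M \<Otimes>\<^sub>M N)"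
    and u: "u \<in> Linfty M" and v: "v \<in> Linfty N" and u': "u' \<in> Linfty M" and v': "v' \<in> Linfty N"
    and crit_u: "\<And>x. x \<in> space M \<Longrightarrow>
      (\<integral>y. exp ((u x + v y - c (x, y)) / \<epsilon>) \<partial>N) = exp (- u x / \<tau>1)"
    and crit_v: "\<And>y. y \<in> space N \<Longrightarrow>
      (\<integral>x. exp ((u x + v y - c (x, y)) / \<epsilon>) \<partial>M) = exp (- v y / \<tau>2)"
  shows "dual_functional \<tau>1 \<tau>2 \<epsilon> M N c u' v' \<le> dual_functional \<tau>1 \<tau>2 \<epsilon> M N c u v"
proof -
  interpret M: finite_measure M by fact
  interpret N: finite_measure N by fact
  interpret pair_sigma_finite M N ..
  interpret P: finite_measure "M \<Otimes>\<^sub>M N"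
    by (rule finite_measure_pair_measure) fact+
  note L = Linfty_const Linfty_add Linfty_mult Linfty_diff Linfty_divide Linfty_minus Linfty_exp
    Linfty_fst Linfty_snd c u v u' v'
  define e where "e z = exp ((u (fst z) + v (snd z) - c z) / \<epsilon>)" for z
  define e' where "e' z = exp ((u' (fst z) + v' (snd z) - c z) / \<epsilon>)" for z
  have eL: "e \<in> Linfty (M \<Otimes>\<^sub>M N)" "e' \<in> Linfty (M \<Otimes>\<^sub>M N)"
    unfolding e_def e'_def by (intro L)+
  \<comment> \<open>The factor \<open>u' (fst z) - u (fst z)\<close> is constant in the second
    coordinate, so integrating over \<open>N\<close> first leaves exactly the integral in
    \<open>crit_u\<close>.\<close>
  have fub_u: "(\<integral>z. e z * (u' (fst z) - u (fst z)) \<partial>(M \<Otimes>\<^sub>M N))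
      = (\<integral>x. exp (- u x / \<tau>1) * (u' x - u x) \<partial>M)" (is "?Iu = ?Ju")
  proof -
    have "integrable (M \<Otimes>\<^sub>M N) (\<lambda>z. e z * (u' (fst z) - u (fst z)))"
      by (intro P.Linfty_integrable L eL)
    from integral_fst'[OF this]
    have "?Iu = (\<integral>x. (\<integral>y. e (x, y) * (u' x - u x) \<partial>N) \<partial>M)"
      by simp
    also have "\<dots> = ?Ju"
      by (intro Bochner_Integration.integral_cong) (simp_all add: e_def crit_u)
    finally show ?thesis .
  qed
  \<comment> \<open>Mirror case: the integral over \<open>M\<close> is now the inner one, to match
    \<open>crit_v\<close>.\<close>
  have fub_v: "(\<integral>z. e z * (v' (snd z) - v (snd z)) \<partial>(M \<Otimes>\<^sub>M N))
      = (\<integral>y. exp (- v y / \<tau>2) * (v' y - v y) \<partial>N)" (is "?Iv = ?Jv")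
  proof -
    have "integrable (M \<Otimes>\<^sub>M N) (case_prod (\<lambda>x y. e (x, y) * (v' y - v y)))"
      using P.Linfty_integrable[of "\<lambda>z. e z * (v' (snd z) - v (snd z))"]
      by (simp add: case_prod_unfold L eL)
    from integral_snd[OF this]
    have "?Iv = (\<integral>y. (\<integral>x. e (x, y) * (v' y - v y) \<partial>M) \<partial>N)"
      by (simp add: case_prod_unfold)
    also have "\<dots> = ?Jv"
      by (intro Bochner_Integration.integral_cong) (simp_all add: e_def crit_v)
    finally show ?thesis .
  qed
  \<comment> \<open>The tangent is taken at the exponent of \<open>e\<close>; the cost drops out of
    the increment, which is the change of \<open>u + v\<close> divided by
    \<open>\<epsilon>\<close>.\<close>
  have main: "(\<integral>z. e z \<partial>(M \<Otimes>\<^sub>M N)) + (?Iu + ?Iv) / \<epsilon> \<le> (\<integral>z. e' z \<partial>(M \<Otimes>\<^sub>M N))"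
  proof -
    have "(\<integral>z. e z \<partial>(M \<Otimes>\<^sub>M N)) + (?Iu + ?Iv) / \<epsilon>
      = (\<integral>z. e z + (e z * (u' (fst z) - u (fst z)) + e z * (v' (snd z) - v (snd z))) / \<epsilon> \<partial>(M \<Otimes>\<^sub>M N))"
      by (simp add: P.Linfty_integrable L eL)
    also have "\<dots> \<le> (\<integral>z. e' z \<partial>(M \<Otimes>\<^sub>M N))"
    proof (intro integral_mono P.Linfty_integrable L eL)
      fix z
      show "e z + (e z * (u' (fst z) - u (fst z)) + e z * (v' (snd z) - v (snd z))) / \<epsilon> \<le> e' z"
        using exp_tangent[of "(u (fst z) + v (snd z) - c z) / \<epsilon>" "(u' (fst z) + v' (snd z) - c z) / \<epsilon>"]
        by (simp add: e_def e'_def diff_divide_distrib add_divide_distrib algebra_simps)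
    qed
    finally show ?thesis .
  qed
  \<comment> \<open>Stated over a fresh type \<open>'c\<close> so that it serves both
    marginals.\<close>
  have marginal: "(\<integral>x. exp (- f x / \<tau>) - 1 \<partial>K) - (\<integral>x. exp (- f x / \<tau>) * (f' x - f x) \<partial>K) / \<tau>
      \<le> (\<integral>x. exp (- f' x / \<tau>) - 1 \<partial>K)"
    if "finite_measure K" "f \<in> Linfty K" "f' \<in> Linfty K" for f f' \<tau> and K :: "'c measure"
  proof -
    interpret K: finite_measure K by fact
    note LK = Linfty_const Linfty_mult Linfty_diff Linfty_divide Linfty_minus Linfty_exp that(2,3)
    have "(\<integral>x. exp (- f x / \<tau>) - 1 \<partial>K) - (\<integral>x. exp (- f x / \<tau>) * (f' x - f x) \<partial>K) / \<tau>
      = (\<integral>x. (exp (- f x / \<tau>) - 1) - exp (- f x / \<tau>) * (f' x - f x) / \<tau> \<partial>K)"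
      by (subst Bochner_Integration.integral_diff) (auto intro!: K.Linfty_integrable LK)
    also have "\<dots> \<le> (\<integral>x. exp (- f' x / \<tau>) - 1 \<partial>K)"
    proof (intro integral_mono K.Linfty_integrable LK)
      fix x
      show "exp (- f x / \<tau>) - 1 - exp (- f x / \<tau>) * (f' x - f x) / \<tau> \<le> exp (- f' x / \<tau>) - 1"
        using exp_tangent[of "- f x / \<tau>" "- f' x / \<tau>"]
        by (simp add: diff_divide_distrib algebra_simps)
    qed
    finally show ?thesis .
  qed
  have mu: "\<tau>1 * (\<integral>x. exp (- u x / \<tau>1) - 1 \<partial>M) - ?Ju \<le> \<tau>1 * (\<integral>x. exp (- u' x / \<tau>1) - 1 \<partial>M)"
    using mult_left_mono[OF marginal[OF assms(1) u u', of \<tau>1], of \<tau>1] pos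
    by (simp add: right_diff_distrib)
  have mv: "\<tau>2 * (\<integral>y. exp (- v y / \<tau>2) - 1 \<partial>N) - ?Jv \<le> \<tau>2 * (\<integral>y. exp (- v' y / \<tau>2) - 1 \<partial>N)"
    using mult_left_mono[OF marginal[OF assms(2) v v', of \<tau>2], of \<tau>2] pos
    by (simp add: right_diff_distrib)
  have mp: "\<epsilon> * (\<integral>z. e z \<partial>(M \<Otimes>\<^sub>M N)) + (?Ju + ?Jv) \<le> \<epsilon> * (\<integral>z. e' z \<partial>(M \<Otimes>\<^sub>M N))"
    using mult_left_mono[OF main, of \<epsilon>] pos by (simp add: distrib_left add_divide_distrib fub_u fub_v)
  have "dual_functional \<tau>1 \<tau>2 \<epsilon> M N c u v = - \<tau>1 * (\<integral>x. exp (- u x / \<tau>1) - 1 \<partial>M)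
      - \<tau>2 * (\<integral>y. exp (- v y / \<tau>2) - 1 \<partial>N) - \<epsilon> * (\<integral>z. e z \<partial>(M \<Otimes>\<^sub>M N))"
    "dual_functional \<tau>1 \<tau>2 \<epsilon> M N c u' v' = - \<tau>1 * (\<integral>x. exp (- u' x / \<tau>1) - 1 \<partial>M)
      - \<tau>2 * (\<integral>y. exp (- v' y / \<tau>2) - 1 \<partial>N) - \<epsilon> * (\<integral>z. e' z \<partial>(M \<Otimes>\<^sub>M N))"
    unfolding dual_functional_def e_def e'_def by (simp_all add: case_prod_unfold)
  \<comment> \<open>Adding \<open>mu\<close>, \<open>mv\<close> and \<open>mp\<close> eliminates
    \<open>?Ju\<close> and \<open>?Jv\<close>.\<close>
  with mu mv mp show ?thesis
    by linarith
qed

section \<open>Fixed points of contractions in the sup norm\<close>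

text \<open>Banach's fixed point theorem by Picard iteration from zero. The contraction hypothesis
  quantifies over every uniform bound \<open>K\<close> of the difference, which avoids forming
  suprema.\<close>

lemma sup_norm_contraction_fixpoint:
  fixes T :: "('a \<Rightarrow> real) \<Rightarrow> 'a \<Rightarrow> real"
  assumes T: "\<And>f. f \<in> bounded_measurable M \<Longrightarrow> T f \<in> bounded_measurable M"
    and q: "0 \<le> q" "q < 1"
    and contr: "\<And>f g K x. f \<in> bounded_measurable M \<Longrightarrow> g \<in> bounded_measurable M \<Longrightarrow>
      (\<And>x. x \<in> space M \<Longrightarrow> \<bar>f x - g x\<bar> \<le> K) \<Longrightarrow> x \<in> space M \<Longrightarrow> \<bar>T f x - T g x\<bar> \<le> q * K"
  shows "\<exists>f\<in>bounded_measurable M. \<forall>x\<in>space M. T f x = f x"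
proof -
  define F where "F n = (T ^^ n) (\<lambda>_. 0)" for n
  have F_simps: "F 0 = (\<lambda>_. 0)" "F (Suc n) = T (F n)" for n
    by (simp_all add: F_def)
  have F: "F n \<in> bounded_measurable M" for n
  proof (induction n)
    case 0
    show ?case
      unfolding F_simps by (rule bounded_measurableI[where C=0]) auto
  qed (simp add: F_simps T)
  obtain K where K: "K \<ge> 0" "\<And>x. x \<in> space M \<Longrightarrow> \<bar>F 1 x\<bar> \<le> K"
    by (rule bounded_measurableE[OF F[of 1]]) blast
  \<comment> \<open>The sum of the geometric series with first term \<open>K\<close> and ratio
    \<open>q\<close>. The identity \<open>q * R + K = R\<close> makes the ball of radius
    \<open>R\<close> around zero stable under the iteration.\<close>
  define R where "R = K / (1 - q)"
  have R: "q * R + K = R"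
    using q by (simp add: R_def field_simps)
  have bound: "\<bar>F k x\<bar> \<le> R" if "x \<in> space M" for k x
    using that
  proof (induction k arbitrary: x)
    case 0
    then show ?case
      using K q by (simp add: F_simps R_def)
  next
    case (Suc k)
    have "\<bar>T (F k) x - T (F 0) x\<bar> \<le> q * R"
      by (rule contr) (use Suc F F[of 0] in \<open>auto simp: F_simps\<close>)
    with K(2)[OF Suc.prems] R show ?case
      by (simp add: F_simps)
  qed
  \<comment> \<open>\<open>F k\<close> differs from \<open>F 0\<close> by at most \<open>R\<close>,
    and each of the \<open>n\<close> further applications of \<open>T\<close> contributes a factor
    \<open>q\<close>.\<close>
  have close: "\<bar>F (n + k) x - F n x\<bar> \<le> q ^ n * R" if "x \<in> space M" for n k x
    using that
  proof (induction n arbitrary: x)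
    case 0
    then show ?case
      using bound by (simp add: F_simps)
  next
    case (Suc n)
    have "\<bar>T (F (n + k)) x - T (F n) x\<bar> \<le> q * (q ^ n * R)"
      by (rule contr) (use Suc F in auto)
    then show ?case
      by (simp add: F_simps mult.assoc)
  qed
  have qlim: "(\<lambda>n. q ^ n * R) \<longlonglongrightarrow> 0"
    using tendsto_mult_right[OF LIMSEQ_realpow_zero[OF q], of R] by simp
  \<comment> \<open>Outside \<open>space M\<close> convergence is not known and \<open>lim\<close>
    may be arbitrary; only values on \<open>space M\<close> are used.\<close>
  define f where "f x = lim (\<lambda>n. F n x)" for x
  have lim: "(\<lambda>n. F n x) \<longlonglongrightarrow> f x" if x: "x \<in> space M" for x
  proof -
    have "Cauchy (\<lambda>n. F n x)"
    proof (rule metric_CauchyI)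
      fix r :: real assume "r > 0"
      then obtain n where n: "q ^ n * R < r / 2"
        using order_tendstoD(2)[OF qlim, of "r / 2"] by (auto simp: eventually_sequentially)
      have "dist (F i x) (F j x) < r" if "i \<ge> n" "j \<ge> n" for i j
        using close[OF x, of n "i - n"] close[OF x, of n "j - n"] that n
        by (simp add: dist_real_def)
      then show "\<exists>n. \<forall>i\<ge>n. \<forall>j\<ge>n. dist (F i x) (F j x) < r"
        by blast
    qed
    then show ?thesis
      unfolding f_def by (simp add: Cauchy_convergent_iff convergent_LIMSEQ_iff)
  qed
  have f_bm: "f \<in> bounded_measurable M"
  proof (rule bounded_measurableI)
    show "f \<in> borel_measurable M"
      by (rule borel_measurable_LIMSEQ_real[OF lim])
        (use F in \<open>auto simp: bounded_measurable_def\<close>)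
    show "\<bar>f x\<bar> \<le> R" if "x \<in> space M" for x
      by (rule LIMSEQ_le_const2[OF tendsto_rabs[OF lim[OF that]]]) (use bound that in auto)
  qed
  \<comment> \<open>Letting \<open>k\<close> tend to infinity in \<open>close\<close> keeps a bound
    uniform in \<open>x\<close>, as \<open>contr\<close> requires of its \<open>K\<close>.\<close>
  have f_close: "\<bar>f x - F n x\<bar> \<le> q ^ n * R" if x: "x \<in> space M" for n x
  proof (rule LIMSEQ_le_const2)
    show "(\<lambda>k. \<bar>F (k + n) x - F n x\<bar>) \<longlonglongrightarrow> \<bar>f x - F n x\<bar>"
      by (intro tendsto_intros LIMSEQ_ignore_initial_segment lim x)
  qed (use close[OF x, of n] in \<open>auto simp: add.commute\<close>)
  \<comment> \<open>The shifted iterates converge to \<open>f x\<close> by construction and to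
    \<open>T f x\<close> by contraction.\<close>
  have "T f x = f x" if x: "x \<in> space M" for x
  proof (rule LIMSEQ_unique)
    show "(\<lambda>n. F (Suc n) x) \<longlonglongrightarrow> f x"
      by (rule LIMSEQ_Suc[OF lim[OF x]])
    have "\<bar>T f x - F (Suc n) x\<bar> \<le> q * (q ^ n * R)" for n
      unfolding F_simps by (rule contr[OF f_bm F f_close x])
    then have "\<forall>\<^sub>F n in sequentially. norm (F (Suc n) x - T f x) \<le> q * (q ^ n * R)"
      by (simp add: abs_minus_commute)
    moreover have "(\<lambda>n. q * (q ^ n * R)) \<longlonglongrightarrow> 0"
      using tendsto_mult_left[OF qlim, of q] by simp
    ultimately have "(\<lambda>n. F (Suc n) x - T f x) \<longlonglongrightarrow> 0"
      by (rule Lim_null_comparison)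
    then show "(\<lambda>n. F (Suc n) x) \<longlonglongrightarrow> T f x"
      using LIM_zero_iff by blast
  qed
  with f_bm show ?thesis
    by blast
qed

section \<open>Logarithms of integrated exponentials\<close>

text \<open>This is where nonzero mass enters: a positive constant below the integrand has positive
  integral. It makes the logarithms below meaningful.\<close>

lemma integral_exp_pos:
  assumes "finite_measure N" "measure N (space N) > 0" "f \<in> bounded_measurable N"
  shows "(\<integral>y. exp (f y) \<partial>N) > 0"
proof -
  interpret N: finite_measure N by fact
  obtain C where C: "\<And>y. y \<in> space N \<Longrightarrow> \<bar>f y\<bar> \<le> C"
    by (rule bounded_measurableE[OF assms(3)]) blast
  have "0 < (\<integral>y. exp (- C) \<partial>N)"
    using assms(2) by simp
  also have "\<dots> \<le> (\<integral>y. exp (f y) \<partial>N)"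
  proof (intro integral_mono N.Linfty_integrable Linfty_exp Linfty_const bounded_measurable_imp_Linfty assms)
    show "exp (- C) \<le> exp (f y)" if "y \<in> space N" for y
      using C[OF that] by simp
  qed
  finally show ?thesis .
qed

text \<open>If \<open>f \<le> g + K\<close> pointwise, the integral of \<open>exp f\<close> is at
  most \<open>exp K\<close> times that of \<open>exp g\<close>, and the logarithm turns the factor
  into the summand \<open>K\<close>. Exchanging \<open>f\<close> and \<open>g\<close> gives the
  absolute value.\<close>

lemma ln_integral_exp_lipschitz:
  assumes fin: "finite_measure N" and pos: "measure N (space N) > 0"
    and f: "f \<in> bounded_measurable N" and g: "g \<in> bounded_measurable N"
    and K: "\<And>y. y \<in> space N \<Longrightarrow> \<bar>f y - g y\<bar> \<le> K"
  shows "\<bar>ln (\<integral>y. exp (f y) \<partial>N) - ln (\<integral>y. exp (g y) \<partial>N)\<bar> \<le> K"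
proof -
  interpret N: finite_measure N by fact
  have *: "ln (\<integral>y. exp (f y) \<partial>N) \<le> ln (\<integral>y. exp (g y) \<partial>N) + K"
    if f: "f \<in> bounded_measurable N" and g: "g \<in> bounded_measurable N"
      and le: "\<And>y. y \<in> space N \<Longrightarrow> f y \<le> g y + K" for f g
  proof -
    have "(\<integral>y. exp (f y) \<partial>N) \<le> (\<integral>y. exp (g y) * exp K \<partial>N)"
    proof (intro integral_mono N.Linfty_integrable Linfty_mult Linfty_exp Linfty_const
        bounded_measurable_imp_Linfty f g)
      show "exp (f y) \<le> exp (g y) * exp K" if "y \<in> space N" for y
        using le[OF that] by (simp flip: exp_add)
    qed
    also have "\<dots> = (\<integral>y. exp (g y) \<partial>N) * exp K"
      by simp
    finally have "ln (\<integral>y. exp (f y) \<partial>N) \<le> ln ((\<integral>y. exp (g y) \<partial>N) * exp K)"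
      using integral_exp_pos[OF fin pos f] by simp
    also have "\<dots> = ln (\<integral>y. exp (g y) \<partial>N) + K"
      using integral_exp_pos[OF fin pos g] by (simp add: ln_mult)
    finally show ?thesis .
  qed
  have "f y \<le> g y + K" "g y \<le> f y + K" if "y \<in> space N" for y
    using K[OF that] by linarith+
  from *[OF f g this(1)] *[OF g f this(2)] show ?thesis
    by linarith
qed

section \<open>The half-step maps\<close>

text \<open>The unbalanced Sinkhorn update; its prefactor is the reciprocal of
  \<open>1 / \<epsilon> + 1 / \<tau>\<close>. The cost is curried with the variable of the result
  first, so swapping its arguments yields the update of the other potential.\<close>

definition sinkhorn_map ::
  "real \<Rightarrow> real \<Rightarrow> 'b measure \<Rightarrow> ('a \<Rightarrow> 'b \<Rightarrow> real) \<Rightarrow> ('b \<Rightarrow> real) \<Rightarrow> 'a \<Rightarrow> real" where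
  "sinkhorn_map \<epsilon> \<tau> N k v x = - (\<epsilon> * \<tau> / (\<epsilon> + \<tau>)) * ln (\<integral>y. exp ((v y - k x y) / \<epsilon>) \<partial>N)"

locale sinkhorn =
  fixes \<epsilon> \<tau> :: real and M :: "'a measure" and N :: "'b measure" and k :: "'a \<Rightarrow> 'b \<Rightarrow> real" and B :: real
  assumes eps: "\<epsilon> > 0" and tau: "\<tau> > 0"
    and finN: "finite_measure N" and posN: "measure N (space N) > 0"
    and k_measurable: "case_prod k \<in> borel_measurable (M \<Otimes>\<^sub>M N)"
    and k_bounded: "\<And>x y. \<bar>k x y\<bar> \<le> B"
begin

lemma exponent_bounded_measurable:
  assumes "v \<in> bounded_measurable N" "x \<in> space M"
  shows "(\<lambda>y. (v y - k x y) / \<epsilon>) \<in> bounded_measurable N"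
proof -
  obtain C where C: "v \<in> borel_measurable N" "\<And>y. y \<in> space N \<Longrightarrow> \<bar>v y\<bar> \<le> C"
    by (rule bounded_measurableE[OF assms(1)]) blast
  note [measurable] = C(1)
  show ?thesis
  proof (rule bounded_measurableI)
    have "(\<lambda>y. k x y) \<in> borel_measurable N"
      using measurable_Pair2[OF k_measurable assms(2)] by simp
    then show "(\<lambda>y. (v y - k x y) / \<epsilon>) \<in> borel_measurable N"
      by measurable
    show "\<bar>(v y - k x y) / \<epsilon>\<bar> \<le> (C + B) / \<epsilon>" if "y \<in> space N" for y
      using C(2)[OF that] k_bounded[of x y] eps
      by (simp add: abs_divide divide_right_mono)
  qed
qed

text \<open>Dividing by \<open>\<epsilon>\<close> in the exponent costs a factor
  \<open>1 / \<epsilon>\<close>, and the prefactor turns this into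
  \<open>\<tau> / (\<epsilon> + \<tau>)\<close>, which is below 1.\<close>

lemma sinkhorn_map_lipschitz:
  assumes "f \<in> bounded_measurable N" "g \<in> bounded_measurable N" "x \<in> space M"
    and K: "\<And>y. y \<in> space N \<Longrightarrow> \<bar>f y - g y\<bar> \<le> K"
  shows "\<bar>sinkhorn_map \<epsilon> \<tau> N k f x - sinkhorn_map \<epsilon> \<tau> N k g x\<bar> \<le> \<tau> / (\<epsilon> + \<tau>) * K"
proof -
  let ?l = "\<lambda>v. ln (\<integral>y. exp ((v y - k x y) / \<epsilon>) \<partial>N)"
  have "\<bar>?l f - ?l g\<bar> \<le> K / \<epsilon>"
  proof (intro ln_integral_exp_lipschitz finN posN exponent_bounded_measurable assms)
    show "\<bar>(f y - k x y) / \<epsilon> - (g y - k x y) / \<epsilon>\<bar> \<le> K / \<epsilon>" if "y \<in> space N" for y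
      using K[OF that] eps by (simp add: abs_divide divide_right_mono flip: diff_divide_distrib)
  qed
  then have "(\<epsilon> * \<tau> / (\<epsilon> + \<tau>)) * \<bar>?l f - ?l g\<bar> \<le> (\<epsilon> * \<tau> / (\<epsilon> + \<tau>)) * (K / \<epsilon>)"
    using eps tau by (intro mult_left_mono) auto
  moreover have "\<bar>sinkhorn_map \<epsilon> \<tau> N k f x - sinkhorn_map \<epsilon> \<tau> N k g x\<bar> = (\<epsilon> * \<tau> / (\<epsilon> + \<tau>)) * \<bar>?l f - ?l g\<bar>"
  proof -
    have "sinkhorn_map \<epsilon> \<tau> N k f x - sinkhorn_map \<epsilon> \<tau> N k g x = (\<epsilon> * \<tau> / (\<epsilon> + \<tau>)) * (?l g - ?l f)"
      unfolding sinkhorn_map_def by (simp add: right_diff_distrib)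
    then show ?thesis
      using eps tau by (simp add: abs_mult abs_minus_commute)
  qed
  ultimately show ?thesis
    using eps by simp
qed

lemma sinkhorn_map_bounded_measurable:
  assumes "v \<in> bounded_measurable N"
  shows "sinkhorn_map \<epsilon> \<tau> N k v \<in> bounded_measurable M"
proof -
  interpret N: finite_measure N by (rule finN)
  obtain C where C: "v \<in> borel_measurable N" "\<And>y. y \<in> space N \<Longrightarrow> \<bar>v y\<bar> \<le> C"
    by (rule bounded_measurableE[OF assms(1)]) blast
  note [measurable] = C(1) k_measurable
  let ?l = "\<lambda>x. ln (\<integral>y. exp ((v y - k x y) / \<epsilon>) \<partial>N)"
  show ?thesis
  proof (rule bounded_measurableI)
    show "sinkhorn_map \<epsilon> \<tau> N k v \<in> borel_measurable M"
      unfolding sinkhorn_map_def by measurable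
    fix x assume x: "x \<in> space M"
    \<comment> \<open>Comparison with the zero exponent, whose integral is the total mass of
      \<open>N\<close>, reduces boundedness to the Lipschitz estimate.\<close>
    have "\<bar>?l x - ln (\<integral>y. exp 0 \<partial>N)\<bar> \<le> (C + B) / \<epsilon>"
    proof (intro ln_integral_exp_lipschitz finN posN exponent_bounded_measurable assms x)
      show "(\<lambda>y. 0) \<in> bounded_measurable N"
        by (rule bounded_measurableI[where C=0]) auto
      show "\<bar>(v y - k x y) / \<epsilon> - 0\<bar> \<le> (C + B) / \<epsilon>" if "y \<in> space N" for y
        using C(2)[OF that] k_bounded[of x y] eps by (simp add: abs_divide divide_right_mono)
    qed
    then have "\<bar>?l x\<bar> \<le> (C + B) / \<epsilon> + \<bar>ln (measure N (space N))\<bar>"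
      by simp
    then show "\<bar>sinkhorn_map \<epsilon> \<tau> N k v x\<bar>
        \<le> (\<epsilon> * \<tau> / (\<epsilon> + \<tau>)) * ((C + B) / \<epsilon> + \<bar>ln (measure N (space N))\<bar>)"
      unfolding sinkhorn_map_def abs_mult using eps tau by (intro mult_mono) auto
  qed
qed

text \<open>With \<open>exp (u / \<epsilon>)\<close> pulled out of the integral, taking logarithms
  makes the condition linear in the number \<open>u\<close>; the map is defined as its
  solution.\<close>

lemma sinkhorn_map_first_order:
  assumes "v \<in> bounded_measurable N" "x \<in> space M" "u = sinkhorn_map \<epsilon> \<tau> N k v x"
  shows "(\<integral>y. exp ((u + v y - k x y) / \<epsilon>) \<partial>N) = exp (- u / \<tau>)"
proof -
  let ?I = "\<integral>y. exp ((v y - k x y) / \<epsilon>) \<partial>N"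
  have pos: "?I > 0"
    by (intro integral_exp_pos finN posN exponent_bounded_measurable assms)
  have "(\<integral>y. exp ((u + v y - k x y) / \<epsilon>) \<partial>N) = (\<integral>y. exp (u / \<epsilon>) * exp ((v y - k x y) / \<epsilon>) \<partial>N)"
    by (simp add: add_diff_eq flip: exp_add add_divide_distrib)
  also have "\<dots> = exp (u / \<epsilon> + ln ?I)"
    using pos by (simp add: exp_add)
  also have "u / \<epsilon> + ln ?I = - u / \<tau>"
    unfolding assms(3) sinkhorn_map_def using eps tau
    by (simp add: divide_simps) (simp add: algebra_simps)
  finally show ?thesis .
qed

end

section \<open>Construction of the maximizer\<close>

theorem mainTheorem1:
  fixes \<mu> :: "'a::polish_space measure" and \<nu> :: "'b::polish_space measure"
    and c :: "'a \<times> 'b \<Rightarrow> real" and \<epsilon> \<tau>1 \<tau>2 :: real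
  assumes "\<epsilon> > 0" and "\<tau>1 > 0" and "\<tau>2 > 0"
    and "sets \<mu> = sets borel" and "finite_measure \<mu>" and "measure \<mu> UNIV > 0"
    and "sets \<nu> = sets borel" and "finite_measure \<nu>" and "measure \<nu> UNIV > 0"
    and "c \<in> Linfty (\<mu> \<Otimes>\<^sub>M \<nu>)"
  shows "\<exists>u\<in>Linfty \<mu>. \<exists>v\<in>Linfty \<nu>. \<forall>u'\<in>Linfty \<mu>. \<forall>v'\<in>Linfty \<nu>.
    dual_functional \<tau>1 \<tau>2 \<epsilon> \<mu> \<nu> c u' v' \<le> dual_functional \<tau>1 \<tau>2 \<epsilon> \<mu> \<nu> c u v"
proof -
  interpret \<mu>: finite_measure \<mu> by fact
  interpret \<nu>: finite_measure \<nu> by fact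
  interpret pair_sigma_finite \<mu> \<nu> ..
  have space: "space \<mu> = UNIV" "space \<nu> = UNIV"
    using sets_eq_imp_space_eq[OF assms(4)] sets_eq_imp_space_eq[OF assms(7)] by simp_all
  obtain C0 where C0: "c \<in> borel_measurable (\<mu> \<Otimes>\<^sub>M \<nu>)" "AE z in \<mu> \<Otimes>\<^sub>M \<nu>. \<bar>c z\<bar> \<le> C0"
    by (rule LinftyE[OF assms(10)])
  \<comment> \<open>The absolute value secures \<open>- C \<le> C\<close>, so the truncation really
    lands between these bounds.\<close>
  define C where "C = \<bar>C0\<bar>"
  \<comment> \<open>The fixed point argument needs pointwise bounds, so \<open>c\<close> is truncated on a null set.\<close>
  define c' where "c' z = max (- C) (min C (c z))" for z
  have c'_meas [measurable]: "c' \<in> borel_measurable (\<mu> \<Otimes>\<^sub>M \<nu>)"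
    using C0(1) unfolding c'_def by measurable
  have c'_bd: "\<bar>c' z\<bar> \<le> C" for z
    unfolding c'_def C_def by auto
  have c'_eq: "AE z in \<mu> \<Otimes>\<^sub>M \<nu>. c z = c' z"
    using C0(2) by eventually_elim (auto simp: c'_def C_def)
  interpret S1: sinkhorn \<epsilon> \<tau>1 \<mu> \<nu> "\<lambda>x y. c' (x, y)" C
    using assms c'_bd by unfold_locales (simp_all add: space case_prod_unfold)
  interpret S2: sinkhorn \<epsilon> \<tau>2 \<nu> \<mu> "\<lambda>y x. c' (x, y)" C
    using assms c'_bd by unfold_locales (simp_all add: space case_prod_unfold)
  let ?S1 = "sinkhorn_map \<epsilon> \<tau>1 \<nu> (\<lambda>x y. c' (x, y))"
  let ?S2 = "sinkhorn_map \<epsilon> \<tau>2 \<mu> (\<lambda>y x. c' (x, y))"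
  \<comment> \<open>Substituting the update of \<open>v\<close> into that of \<open>u\<close> leaves
    an equation in \<open>u\<close> alone.\<close>
  have "\<exists>u\<in>bounded_measurable \<mu>. \<forall>x\<in>space \<mu>. ?S1 (?S2 u) x = u x"
  proof (rule sup_norm_contraction_fixpoint)
    show "?S1 (?S2 u) \<in> bounded_measurable \<mu>" if "u \<in> bounded_measurable \<mu>" for u
      by (intro S1.sinkhorn_map_bounded_measurable S2.sinkhorn_map_bounded_measurable that)
    let ?q = "\<tau>1 / (\<epsilon> + \<tau>1) * (\<tau>2 / (\<epsilon> + \<tau>2))"
    show "0 \<le> ?q"
      using assms(1-3) by simp
    have "?q < 1 * 1"
      using assms(1-3) by (intro mult_strict_mono) auto
    then show "?q < 1"
      by simp
    fix f g K x
    assume "f \<in> bounded_measurable \<mu>" "g \<in> bounded_measurable \<mu>" "x \<in> space \<mu>"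
      and "\<And>x. x \<in> space \<mu> \<Longrightarrow> \<bar>f x - g x\<bar> \<le> K"
    then show "\<bar>?S1 (?S2 f) x - ?S1 (?S2 g) x\<bar> \<le> ?q * K"
      unfolding mult.assoc
      by (intro S1.sinkhorn_map_lipschitz S2.sinkhorn_map_lipschitz
          S2.sinkhorn_map_bounded_measurable)
  qed
  then obtain u where u: "u \<in> bounded_measurable \<mu>" "\<And>x. u x = ?S1 (?S2 u) x"
    by (auto simp: space)
  \<comment> \<open>With this choice the condition in \<open>v\<close> holds by construction, and
    the one in \<open>u\<close> is the fixed point equation.\<close>
  define v where "v = ?S2 u"
  have v: "v \<in> bounded_measurable \<nu>"
    unfolding v_def by (intro S2.sinkhorn_map_bounded_measurable u)
  have uv: "u \<in> Linfty \<mu>" "v \<in> Linfty \<nu>"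
    using u v by (auto intro: bounded_measurable_imp_Linfty)
  \<comment> \<open>The cost enters only through the product integral, which ignores the null set
    where \<open>c\<close> and \<open>c'\<close> differ; optimality for \<open>c'\<close> therefore
    transfers to \<open>c\<close>.\<close>
  have D_eq: "dual_functional \<tau>1 \<tau>2 \<epsilon> \<mu> \<nu> c f g = dual_functional \<tau>1 \<tau>2 \<epsilon> \<mu> \<nu> c' f g"
    if "f \<in> Linfty \<mu>" "g \<in> Linfty \<nu>" for f g
  proof -
    note [measurable] = that[THEN Linfty_measurable] C0(1)
    have "(\<integral>z. exp ((f (fst z) + g (snd z) - c z) / \<epsilon>) \<partial>(\<mu> \<Otimes>\<^sub>M \<nu>))
        = (\<integral>z. exp ((f (fst z) + g (snd z) - c' z) / \<epsilon>) \<partial>(\<mu> \<Otimes>\<^sub>M \<nu>))"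
    proof (rule integral_cong_AE)
      show "AE z in \<mu> \<Otimes>\<^sub>M \<nu>. exp ((f (fst z) + g (snd z) - c z) / \<epsilon>)
          = exp ((f (fst z) + g (snd z) - c' z) / \<epsilon>)"
        using c'_eq by eventually_elim simp
    qed measurable
    then show ?thesis
      unfolding dual_functional_def by (simp add: case_prod_unfold)
  qed
  have "dual_functional \<tau>1 \<tau>2 \<epsilon> \<mu> \<nu> c' u' v' \<le> dual_functional \<tau>1 \<tau>2 \<epsilon> \<mu> \<nu> c' u v"
    if "u' \<in> Linfty \<mu>" "v' \<in> Linfty \<nu>" for u' v'
  proof (rule dual_functional_le_critical_point)
    show "c' \<in> Linfty (\<mu> \<Otimes>\<^sub>M \<nu>)"
      by (rule LinftyI[where C=C]) (use c'_bd in auto)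
    show "(\<integral>y. exp ((u x + v y - c' (x, y)) / \<epsilon>) \<partial>\<nu>) = exp (- u x / \<tau>1)" if "x \<in> space \<mu>" for x
      by (rule S1.sinkhorn_map_first_order) (use v u(2) that in \<open>auto simp: v_def\<close>)
    show "(\<integral>x. exp ((u x + v y - c' (x, y)) / \<epsilon>) \<partial>\<mu>) = exp (- v y / \<tau>2)" if "y \<in> space \<nu>" for y
      using S2.sinkhorn_map_first_order[OF u(1) that, of "v y"] by (simp add: v_def add.commute)
  qed (use assms uv that in auto)
  with D_eq uv show ?thesis
    by (intro bexI[of _ u] bexI[of _ v]) auto
qed

end
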